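(* Let $K\subset\mathbb{R}^2$ be a convex body and write $r=r(K)$, $w=w(K)$, $D=D(K)$, $R=R(K)$. Then \[ w\ \le\ 2r\left(1+\frac{2rR}{D^2}\left(1+\sqrt{1-\left(\frac{D}{2R}\right)^2}\right)\right). \]
   Context: For a convex body $K\subset\mathbb{R}^n$: $D(K)$ is the largest distance between two points of $K$; $w(K)$ is the smallest distance between two distinct parallel supporting lines/hyperplanes of $K$; $r(K)$ is the radius of a largest Euclidean ball contained in $K$; $R(K)$ is the radius of the smallest Euclidean ball containing $K$. *)

theory Defs
  imports "HOL-Analysis.Analysis"
begin

definition convex_body :: "'a::euclidean_space set \<Rightarrow> bool" where
  "convex_body K \<longleftrightarrow> compact K \<and> convex K \<and> interior K \<noteq> {}"

abbreviation diam :: "'a::euclidean_space set \<Rightarrow> real" where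
  "diam K \<equiv> diameter K"

text \<open>Minimal width w(K): smallest distance between two parallel supporting
  hyperplanes, i.e. the infimum over unit directions u of the distance
  between the two supporting hyperplanes orthogonal to u.\<close>
definition width :: "'a::euclidean_space set \<Rightarrow> real" where
  "width K = (INF u\<in>sphere 0 1. (SUP x\<in>K. u \<bullet> x) - (INF x\<in>K. u \<bullet> x))"

definition inradius :: "'a::euclidean_space set \<Rightarrow> real" where
  "inradius K = Sup {r. \<exists>c. cball c r \<subseteq> K}"

definition circumradius :: "'a::euclidean_space set \<Rightarrow> real" where
  "circumradius K = Inf {r. \<exists>c. K \<subseteq> cball c r}"

end

theory Submission
  imports Defs
begin

text \<open>Let \<open>w > 2 r\<close> and let the incircle, centered at the origin, touch \<open>K\<close> at \<open>r u\<close>, \<open>r v\<close>, \<open>r t\<close>, where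
  the origin is a positive combination of the unit vectors \<open>u, v, t\<close>; their three cones cover the plane.
  The endpoints \<open>p, q\<close> of a diameter can be put into different cones, say those of
  \<open>u, v\<close> and \<open>u, t\<close>. A point \<open>x \<in> K\<close> farthest from the tangent line with normal \<open>u\<close> has distance at least
  \<open>w\<close> from it and lies in the third cone. Hence the segments \<open>xp\<close> and \<open>xq\<close> meet the incircle disc,
  and prolonging them to the tangent line gives a triangle of height \<open>H \<ge> w\<close> with all sides at distance at most
  \<open>r\<close> from the center. Its base is at least \<open>D\<close>, because \<open>K\<close> lies in the strip
  perpendicular to \<open>pq\<close>. So the angle \<open>A\<close> at \<open>x\<close> satisfies \<open>cot (A/2) \<ge> D (w - 2 r) / (2 r\<^sup>2)\<close>.
  On the other hand \<open>p, q, x\<close> lie in a disc of radius \<open>R\<close>, which forces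
  \<open>cot (A/2) \<le> (2 R + sqrt (4 R\<^sup>2 - D\<^sup>2)) / D\<close>.\<close>


section \<open>Plane vectors and the circumscribed disc\<close>

definition cross2 :: "real^2 \<Rightarrow> real^2 \<Rightarrow> real" where
  "cross2 a b = a$1 * b$2 - a$2 * b$1"

lemma inner_2: "a \<bullet> b = a$1 * b$1 + a$2 * b$2" for a b :: "real^2"
  by (simp add: inner_vec_def sum_2)

lemma cross2_inner_sq: "(cross2 a b)\<^sup>2 + (a \<bullet> b)\<^sup>2 = (norm a)\<^sup>2 * (norm b)\<^sup>2"
  unfolding power2_norm_eq_inner unfolding inner_2 cross2_def power2_eq_square by algebra

lemma abs_cross2_le: "\<bar>cross2 a b\<bar> \<le> norm a * norm b"
proof (rule power2_le_imp_le)
  show "\<bar>cross2 a b\<bar>\<^sup>2 \<le> (norm a * norm b)\<^sup>2"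
    using cross2_inner_sq[of a b] by (simp add: power_mult_distrib) (smt (verit) zero_le_power2)
qed simp

text \<open>In the plane \<open>f\<close> is a multiple of \<open>u\<close> turned by a right angle,
  so this is the area of a parallelogram as height times base.\<close>

lemma abs_cross2_orthogonal:
  assumes "norm u = 1" "u \<bullet> f = 0"
  shows "\<bar>cross2 e f\<bar> = \<bar>u \<bullet> e\<bar> * norm f"
proof -
  have 1: "u$1 * u$1 + u$2 * u$2 = 1"
    using assms(1) by (metis inner_2 norm_eq_1)
  have 2: "u$1 * f$1 + u$2 * f$2 = 0"
    using assms(2) by (simp add: inner_2)
  have "(cross2 e f)\<^sup>2 = (u \<bullet> e)\<^sup>2 * (norm f)\<^sup>2"
    unfolding power2_norm_eq_inner unfolding inner_2 cross2_def power2_eq_square using 1 2 by algebra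
  then have "(\<bar>cross2 e f\<bar>)\<^sup>2 = (\<bar>u \<bullet> e\<bar> * norm f)\<^sup>2"
    by (simp add: power_mult_distrib)
  then show ?thesis
    by (meson abs_ge_zero mult_nonneg_nonneg norm_ge_zero power2_eq_imp_eq)
qed

text \<open>For the triangle \<open>y\<close>, \<open>d\<close>, \<open>- d\<close>,
  \<open>H\<close> is the area and \<open>M\<close> the inner product of the sides at
  \<open>y\<close>, so \<open>M / (2 * H)\<close> is the cotangent of the angle there. If that angle
  is acute, the circumcenter has distance at most \<open>sqrt (R\<^sup>2 - d \<bullet> d)\<close>
  from the base.\<close>

lemma circumball_cot_aux:
  fixes y d z :: "'a::real_inner"
  assumes R: "norm (y - z) \<le> R" "norm (d - z) \<le> R" "norm (- d - z) \<le> R"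
    and yd: "\<bar>y \<bullet> d\<bar> \<le> d \<bullet> d" and d: "d \<noteq> 0"
    and M: "M = y \<bullet> y - d \<bullet> d" and H: "H \<ge> 0" "H\<^sup>2 = (y \<bullet> y) * (d \<bullet> d) - (y \<bullet> d)\<^sup>2"
  shows "M * norm d \<le> 2 * H * sqrt (R\<^sup>2 - d \<bullet> d)"
proof -
  define e where "e = d \<bullet> d"
  have e: "e > 0" using d by (simp add: e_def)
  define S where "S = (y \<bullet> d) / e"
  \<comment> \<open>The altitude from the base line to \<open>y\<close>. The circumcenter lies on
    the line through the origin in this direction.\<close>
  define g where "g = y - S *\<^sub>R d"
  have S: "\<bar>S\<bar> \<le> 1" using yd e by (simp add: S_def e_def[symmetric])
  have ySd: "y \<bullet> d = S * e" using e by (simp add: S_def)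
  have gg: "g \<bullet> g = y \<bullet> y - S\<^sup>2 * e"
    by (simp add: g_def inner_diff ySd inner_commute[of d y] e_def[symmetric] power2_eq_square algebra_simps)
  have H2: "H\<^sup>2 = e * (g \<bullet> g)"
    unfolding H(2) gg ySd by (simp add: e_def[symmetric] power2_eq_square algebra_simps)
  have S2: "S\<^sup>2 \<le> 1" using S by (simp add: abs_square_le_1)
  then have Mg: "M \<le> g \<bullet> g"
    using e by (simp add: gg M e_def[symmetric])
  have sq: "(y - z) \<bullet> (y - z) \<le> R\<^sup>2" "(d - z) \<bullet> (d - z) \<le> R\<^sup>2" "(- d - z) \<bullet> (- d - z) \<le> R\<^sup>2"
    using R[THEN power_mono[OF _ norm_ge_zero, of _ _ 2]] by (simp_all only: power2_norm_eq_inner)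
  have Re: "e \<le> R\<^sup>2"
  proof -
    have "2 * e + 2 * (z \<bullet> z) = (d - z) \<bullet> (d - z) + (- d - z) \<bullet> (- d - z)"
      by (simp add: inner_diff inner_commute e_def)
    then show ?thesis using sq inner_ge_zero[of z] by linarith
  qed
  show ?thesis
  proof (cases "M \<le> 0")
    case True
    then have "M * norm d \<le> 0" by (simp add: mult_nonpos_nonneg)
    also have "0 \<le> 2 * H * sqrt (R\<^sup>2 - d \<bullet> d)" using H(1) Re by (simp add: e_def)
    finally show ?thesis .
  next
    case False
    then have gpos: "g \<bullet> g > 0" using Mg by linarith
    \<comment> \<open>The weights below are the barycentric coordinates of the circumcenter of \<open>y, d, - d\<close>.\<close>
    define t where "t = M / (2 * (g \<bullet> g))"
    have t: "0 \<le> t" "t \<le> 1/2"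
      using False Mg gpos by (auto simp: t_def field_simps)
    have tS: "\<bar>t * S\<bar> \<le> t"
      using t S by (simp add: abs_mult mult_left_le)
    have w: "(1 - t - t * S) / 2 \<ge> 0" "(1 - t + t * S) / 2 \<ge> 0"
      using tS t by auto
    \<comment> \<open>A weighted mean of the squared distances from \<open>z\<close> to the vertices
      equals the squared distance from \<open>z\<close> to the circumcenter
      \<open>t *\<^sub>R g\<close> plus a term free of \<open>z\<close>; dropping the square removes
      the unknown center.\<close>
    have "t * ((y - z) \<bullet> (y - z)) + (1 - t - t*S)/2 * ((d - z) \<bullet> (d - z)) + (1 - t + t*S)/2 * ((- d - z) \<bullet> (- d - z))
        \<le> t * R\<^sup>2 + (1 - t - t*S)/2 * R\<^sup>2 + (1 - t + t*S)/2 * R\<^sup>2"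
      using w t sq by (intro add_mono mult_left_mono) auto
    also have "\<dots> = R\<^sup>2" by (simp add: field_simps)
    also have "t * ((y - z) \<bullet> (y - z)) + (1 - t - t*S)/2 * ((d - z) \<bullet> (d - z)) + (1 - t + t*S)/2 * ((- d - z) \<bullet> (- d - z))
       = (z - t *\<^sub>R g) \<bullet> (z - t *\<^sub>R g) - t\<^sup>2 * (g \<bullet> g) + t * M + e"
    proof -
      have "(y - z) \<bullet> (y - z) = y \<bullet> y - 2 * (z \<bullet> y) + z \<bullet> z"
        "(d - z) \<bullet> (d - z) = e - 2 * (z \<bullet> d) + z \<bullet> z"
        "(- d - z) \<bullet> (- d - z) = e + 2 * (z \<bullet> d) + z \<bullet> z"
        by (simp_all add: inner_diff inner_commute e_def)
      moreover have "(z - t *\<^sub>R g) \<bullet> (z - t *\<^sub>R g) = z \<bullet> z - 2 * t * (z \<bullet> g) + t\<^sup>2 * (g \<bullet> g)"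
        by (simp add: inner_diff inner_commute power2_eq_square algebra_simps)
      moreover have "z \<bullet> g = z \<bullet> y - S * (z \<bullet> d)"
        by (simp add: g_def inner_diff)
      moreover have "M = y \<bullet> y - e" by (simp add: M e_def)
      ultimately show ?thesis by (simp only:) (simp add: field_simps)
    qed
    finally have "t * M - t\<^sup>2 * (g \<bullet> g) \<le> R\<^sup>2 - e"
      using inner_ge_zero[of "z - t *\<^sub>R g"] by linarith
    also have "t * M - t\<^sup>2 * (g \<bullet> g) = M\<^sup>2 / (4 * (g \<bullet> g))"
      using gpos by (simp add: t_def field_simps power2_eq_square)
    finally have "M\<^sup>2 \<le> 4 * (g \<bullet> g) * (R\<^sup>2 - e)" using gpos by (simp add: field_simps)
    then have "M\<^sup>2 * e \<le> 4 * (g \<bullet> g) * (R\<^sup>2 - e) * e" using e by (simp add: mult_right_mono)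
    then have "(M * norm d)\<^sup>2 \<le> (2 * H * sqrt (R\<^sup>2 - d \<bullet> d))\<^sup>2"
      using Re by (simp add: power_mult_distrib H2 power2_norm_eq_inner e_def mult_ac)
    then show ?thesis
      by (rule power2_le_imp_le) (use H(1) Re in \<open>simp add: e_def\<close>)
  qed
qed

text \<open>With \<open>A\<close> the angle of the triangle at \<open>x\<close>, this says
  \<open>cot (A/2) \<le> 2 (R + k) / D\<close> for \<open>k\<^sup>2 = R\<^sup>2 - D\<^sup>2/4\<close>.\<close>

lemma circumball_cot_bound:
  fixes x p q c :: "'a::real_inner"
  assumes R: "norm (x - c) \<le> R" "norm (p - c) \<le> R" "norm (q - c) \<le> R"
    and acute: "(x - p) \<bullet> (q - p) \<ge> 0" "(x - q) \<bullet> (p - q) \<ge> 0"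
    and D: "norm (q - p) = D" "D > 0"
    and N: "N \<ge> 0" "N\<^sup>2 + ((p - x) \<bullet> (q - x))\<^sup>2 = (norm (p - x))\<^sup>2 * (norm (q - x))\<^sup>2"
  shows "D * (norm (p - x) * norm (q - x) + (p - x) \<bullet> (q - x)) \<le> 2 * N * (R + sqrt (R\<^sup>2 - D\<^sup>2/4))"
proof -
  define k where "k = sqrt (R\<^sup>2 - D\<^sup>2/4)"
  define M where "M = (p - x) \<bullet> (q - x)"
  define m where "m = (1/2) *\<^sub>R (p + q)"
  define y where "y = x - m"
  define d where "d = (1/2) *\<^sub>R (q - p)"
  define z where "z = c - m"
  have p: "p = m - d" and q: "q = m + d" and x: "x = m + y" and c: "c = m + z"
    by (simp_all add: y_def m_def d_def z_def algebra_simps flip: scaleR_left.add)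
  have nd: "norm d = D/2" using D by (simp add: d_def)
  have dd: "d \<bullet> d = D\<^sup>2/4"
    by (simp add: nd power_divide flip: power2_norm_eq_inner)
  have M2: "M = y \<bullet> y - d \<bullet> d"
    by (simp add: M_def p q x inner_diff inner_add inner_commute)
  have R0: "R \<ge> 0" using R(1) norm_ge_zero order_trans by blast
  have DR: "D\<^sup>2/4 \<le> R\<^sup>2"
  proof -
    have "D \<le> 2 * R" using D(1) R(2,3) norm_triangle_ineq4[of "q - c" "p - c"] by simp
    then have "D\<^sup>2 \<le> (2*R)\<^sup>2" using D(2) by (intro power_mono) auto
    then show ?thesis by simp
  qed
  have H2: "(N/2)\<^sup>2 = (y \<bullet> y) * (d \<bullet> d) - (y \<bullet> d)\<^sup>2"
  proof -
    have "N\<^sup>2 = 4 * ((y \<bullet> y) * (d \<bullet> d) - (y \<bullet> d)\<^sup>2)"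
      using N(2) unfolding power2_norm_eq_inner p q x
      by (simp add: inner_diff inner_add inner_commute power2_eq_square algebra_simps)
    then show ?thesis by (simp add: power_divide)
  qed
  have "M * norm d \<le> 2 * (N/2) * sqrt (R\<^sup>2 - d \<bullet> d)"
  proof (rule circumball_cot_aux[OF _ _ _ _ _ M2 _ H2])
    show "norm (y - z) \<le> R" "norm (d - z) \<le> R" "norm (- d - z) \<le> R"
      using R by (simp_all add: p q x c)
    show "\<bar>y \<bullet> d\<bar> \<le> d \<bullet> d" using acute
      by (simp add: p q x inner_diff inner_add inner_commute abs_le_iff)
    show "d \<noteq> 0" using nd D(2) by auto
  qed (use N in auto)
  then have MD: "M * D \<le> 2 * N * k" by (simp add: nd dd k_def)
  define B where "B = norm (p - x) * norm (q - x)"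
  have B2: "B\<^sup>2 = N\<^sup>2 + M\<^sup>2" using N by (simp add: B_def M_def power_mult_distrib)
  have k0: "k \<ge> 0" and k2: "k\<^sup>2 = R\<^sup>2 - D\<^sup>2/4" using DR by (auto simp: k_def)
  \<comment> \<open>The half-angle formula reads \<open>cot (A/2) = (B + M) / N\<close>. With
    \<open>M\<close> moved to the right side and \<open>X = 2 * N * k - M * D \<ge> 0\<close>, the
    squares of the two sides differ by \<open>4 * N * (R + k) * X\<close>.\<close>
  have "(D * B)\<^sup>2 = D\<^sup>2 * N\<^sup>2 + (M * D)\<^sup>2" by (simp add: B2 power_mult_distrib algebra_simps)
  also have "\<dots> \<le> (2 * N * R + (2 * N * k - M * D))\<^sup>2"
  proof -
    have "k\<^sup>2 \<le> R\<^sup>2" using k2 by simp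
    then have "k \<le> R" using R0 by (rule power2_le_imp_le)
    then have "N * k \<le> N * R" "0 \<le> N * k" using N(1) k0 by (auto intro: mult_left_mono)
    then have "0 \<le> (2 * N * R + 2 * N * k) * (2 * N * k - M * D)"
      using MD by (intro mult_nonneg_nonneg) auto
    moreover have "(2 * N * R + (2 * N * k - M * D))\<^sup>2 - (D\<^sup>2 * N\<^sup>2 + (M * D)\<^sup>2)
       = 4 * N\<^sup>2 * (R\<^sup>2 - D\<^sup>2/4 - k\<^sup>2) + 2 * ((2 * N * R + 2 * N * k) * (2 * N * k - M * D))"
      by (simp add: power2_eq_square algebra_simps)
    moreover have "R\<^sup>2 - D\<^sup>2/4 - k\<^sup>2 = 0" using k2 by simp
    ultimately show ?thesis by (metis (no_types, lifting) add_0 diff_ge_0_iff_ge mult_zero_right mult_2 add_nonneg_nonneg)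
  qed
  finally have "D * B \<le> 2 * N * R + (2 * N * k - M * D)"
    using MD N(1) R0 by (intro power2_le_imp_le[of "D * B"]) auto
  then show ?thesis by (simp add: B_def M_def k_def algebra_simps)
qed


section \<open>Cones spanned by contact normals\<close>

text \<open>As \<open>u \<bullet> v\<close> lies between -1 and 1,
  \<open>a - b \<le> y \<bullet> u\<close> and \<open>b - a \<le> y \<bullet> v\<close>. Points far
  behind a tangent line are thereby kept out of the two cones next to its normal.\<close>

lemma cone_inner_lower_bound:
  fixes u v y :: "'a::real_inner"
  assumes "norm u = 1" "norm v = 1" "y = a *\<^sub>R u + b *\<^sub>R v" "a \<ge> 0" "b \<ge> 0"
    and "y \<bullet> u \<le> r"
  shows "y \<bullet> v \<ge> - r"
proof (rule ccontr)
  assume "\<not> y \<bullet> v \<ge> - r"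
  then have yv: "y \<bullet> v < - r" by simp
  define C where "C = u \<bullet> v"
  have C: "\<bar>C\<bar> \<le> 1" using Cauchy_Schwarz_ineq2[of u v] assms(1,2) by (simp add: C_def)
  have uv: "u \<bullet> u = 1" "v \<bullet> v = 1" using assms(1,2) by (simp_all add: norm_eq_1)
  have e1: "y \<bullet> u = a + b * C" and e2: "y \<bullet> v = a * C + b"
    by (simp_all add: assms(3) inner_add uv C_def inner_commute)
  have aC: "- a \<le> a * C" using mult_left_mono[of "-1" C a] C assms(4) by auto
  have bC: "- b \<le> b * C" using mult_left_mono[of "-1" C b] C assms(5) by auto
  have "a - b > r" using yv e2 aC by linarith
  then show False using e1 assms(6) bC by linarith
qed

text \<open>The two cones share the ray of \<open>v\<close>, and the segment crosses the line of
  \<open>v\<close>. The crossing point is a multiple of \<open>v\<close> whose coefficient is a mean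
  of \<open>x \<bullet> v\<close> and \<open>p \<bullet> v\<close>.\<close>

lemma cone_segment_meets_ball:
  fixes u v t x p :: "'a::real_inner"
  assumes n: "norm u = 1" "norm v = 1" "norm t = 1"
    and l: "l1 > 0" "l2 > 0" "l3 > 0" "l1 *\<^sub>R u + l2 *\<^sub>R v + l3 *\<^sub>R t = 0"
    and x: "x = a2 *\<^sub>R v + a3 *\<^sub>R t" "a2 \<ge> 0" "a3 \<ge> 0"
    and p: "p = b1 *\<^sub>R u + b2 *\<^sub>R v" "b1 \<ge> 0" "b2 \<ge> 0"
    and bd: "\<bar>x \<bullet> v\<bar> \<le> r" "\<bar>p \<bullet> v\<bar> \<le> r"
  shows "\<exists>s. norm (x + s *\<^sub>R (p - x)) \<le> r"
proof -
  have *: "\<exists>s c. 0 \<le> s \<and> s \<le> 1 \<and> x + s *\<^sub>R (p - x) = c *\<^sub>R v"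
  proof (cases "a3 * l1 + b1 * l3 = 0")
    case True
    then have "a3 * l1 = 0"
      using l x p by (smt (verit) mult_nonneg_nonneg)
    then have "a3 = 0" using l by simp
    then show ?thesis using x by (intro exI[of _ 0] exI[of _ a2]) auto
  next
    case False
    define w where "w = a3 * l1 + b1 * l3"
    have w: "w > 0" using False l x p by (smt (verit) mult_nonneg_nonneg w_def)
    \<comment> \<open>Chosen so that in \<open>(1 - s) *\<^sub>R x + s *\<^sub>R p\<close> the
      coefficients of \<open>u\<close> and \<open>t\<close> have ratio \<open>l1 : l3\<close>; the
      linear relation then turns both into a multiple of \<open>v\<close>.\<close>
    define s where "s = a3 * l1 / w"
    have s: "0 \<le> s" "s \<le> 1" using w l x p by (auto simp: s_def w_def)
    have s1: "1 - s = b1 * l3 / w" using w by (simp add: s_def w_def field_simps)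
    have "x + s *\<^sub>R (p - x) = (1 - s) *\<^sub>R x + s *\<^sub>R p" by (simp add: algebra_simps)
    also have "\<dots> = ((1-s) * a2 + s * b2) *\<^sub>R v + (b1 * a3 / w) *\<^sub>R (l1 *\<^sub>R u + l3 *\<^sub>R t)"
      unfolding s1 by (simp add: x p s_def algebra_simps)
    also have "l1 *\<^sub>R u + l3 *\<^sub>R t = (- l2) *\<^sub>R v" using l(4) by (simp add: algebra_simps eq_neg_iff_add_eq_0)
    finally have "x + s *\<^sub>R (p - x) = ((1-s) * a2 + s * b2 - b1 * a3 / w * l2) *\<^sub>R v"
      by (simp add: algebra_simps)
    then show ?thesis using s by blast
  qed
  then obtain s c where s: "0 \<le> s" "s \<le> 1" and c: "x + s *\<^sub>R (p - x) = c *\<^sub>R v" by blast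
  have "c = (1 - s) * (x \<bullet> v) + s * (p \<bullet> v)"
    using arg_cong[OF c, of "\<lambda>z. z \<bullet> v"] n(2) by (simp add: norm_eq_1 inner_add inner_diff algebra_simps)
  then have "\<bar>c\<bar> \<le> (1 - s) * \<bar>x \<bullet> v\<bar> + s * \<bar>p \<bullet> v\<bar>"
    using s abs_triangle_ineq[of "(1 - s) * (x \<bullet> v)" "s * (p \<bullet> v)"] by (simp add: abs_mult)
  also have "\<dots> \<le> (1 - s) * r + s * r"
    using s bd by (intro add_mono mult_left_mono) auto
  finally have "\<bar>c\<bar> \<le> (1 - s) * r + s * r" .
  then have "norm (x + s *\<^sub>R (p - x)) \<le> r" using n(2) c by (simp add: algebra_simps)
  then show ?thesis by blast
qed

text \<open>The hypotheses on \<open>d\<close> force \<open>r \<le> a - b\<close>, whereas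
  \<open>p \<bullet> u \<le> r\<close> says \<open>a + b * (u \<bullet> v) \<le> r\<close>. As
  \<open>u \<bullet> v > - 1\<close>, only \<open>b = 0\<close> and \<open>a = r\<close>
  remain.\<close>

lemma same_cone_aux:
  fixes u v d :: "'a::real_inner"
  assumes n: "norm u = 1" "norm v = 1" "norm d = 1" "u \<bullet> v \<noteq> - 1" and r: "r > 0"
    and p: "p = a *\<^sub>R u + b *\<^sub>R v" "a \<ge> 0" "b \<ge> 0" "p \<bullet> u \<le> r" "p \<bullet> v \<le> r" "p \<bullet> d \<le> - r"
    and uvd: "(u + v) \<bullet> d \<ge> 0" and ud: "u \<bullet> d < 0"
  shows "p = r *\<^sub>R u"
proof -
  define C where "C = u \<bullet> v"
  define U where "U = - (u \<bullet> d)"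
  have C: "\<bar>C\<bar> \<le> 1" using Cauchy_Schwarz_ineq2[of u v] n by (simp add: C_def)
  have U: "\<bar>U\<bar> \<le> 1" using Cauchy_Schwarz_ineq2[of u d] n by (simp add: U_def)
  have C1: "1 + C > 0" using C n(4) by (simp add: C_def)
  have V: "U \<le> v \<bullet> d" using uvd by (simp add: U_def inner_add)
  have "p \<bullet> d = - a * U + b * (v \<bullet> d)" by (simp add: p(1) inner_add U_def)
  then have "r \<le> a * U - b * (v \<bullet> d)" using p(6) by simp
  also have "\<dots> \<le> a * U - b * U" using V p(3) by (simp add: mult_left_mono)
  finally have 1: "r \<le> (a - b) * U" by (simp add: algebra_simps)
  then have "a - b > 0" using r ud by (smt (verit) U_def mult_nonpos_nonneg)
  then have 2: "r \<le> a - b" using 1 U by (smt (verit) mult_left_le)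
  have "a + b * C \<le> r" using p(4) n by (simp add: p(1) inner_add norm_eq_1 C_def inner_commute)
  then have "b * (1 + C) \<le> 0" using 2 by (simp add: algebra_simps)
  then have b: "b = 0" using C1 p(3) by (simp add: mult_le_0_iff)
  then have "a = r" using 2 \<open>a + b * C \<le> r\<close> by simp
  then show ?thesis using b p(1) by simp
qed

text \<open>Serves the case of both diameter endpoints in one cone: one of them must be a contact
  point. Since \<open>p \<bullet> d < 0\<close>, \<open>u\<close> or \<open>v\<close> has negative
  inner product with \<open>d\<close>, which is the situation of
  \<open>same_cone_aux\<close>.\<close>

lemma same_cone_contact:
  fixes u v d :: "'a::real_inner"
  assumes n: "norm u = 1" "norm v = 1" "norm d = 1" "u \<bullet> v \<noteq> - 1" and r: "r > 0"
    and p: "p = a *\<^sub>R u + b *\<^sub>R v" "a \<ge> 0" "b \<ge> 0" "p \<bullet> u \<le> r" "p \<bullet> v \<le> r" "p \<bullet> d \<le> - r"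
    and uvd: "(u + v) \<bullet> d \<ge> 0"
  shows "p = r *\<^sub>R u \<or> p = r *\<^sub>R v"
proof (cases "u \<bullet> d < 0")
  case True
  then show ?thesis using same_cone_aux[OF n r p uvd] by blast
next
  case False
  have "p \<bullet> d = a * (u \<bullet> d) + b * (v \<bullet> d)" by (simp add: p(1) inner_add)
  then have "b * (v \<bullet> d) < 0" using p(2,6) False r by (smt (verit) mult_nonneg_nonneg)
  then have "v \<bullet> d < 0" using p(3) by (simp add: mult_less_0_iff)
  moreover have "p = b *\<^sub>R v + a *\<^sub>R u" by (simp add: p(1))
  moreover have "(v + u) \<bullet> d \<ge> 0" using uvd by (simp add: add.commute)
  moreover have "v \<bullet> u \<noteq> - 1" using n by (simp add: inner_commute)
  ultimately show ?thesis using same_cone_aux[of v u d r p b a] n r p by blast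
qed


section \<open>Triangles with base on a tangent line\<close>

text \<open>The triangle \<open>x\<close>, \<open>x + e\<close>, \<open>x + f\<close> has all side lines at distance at most \<open>r\<close> from the origin, so twice
  its area is at most \<open>r\<close> times its perimeter; no assumption on the position of the origin is needed.\<close>

lemma base_triangle_bound:
  fixes x e f u :: "real^2"
  assumes u: "norm u = 1" and ue: "u \<bullet> e = H" "u \<bullet> f = H" and ux: "u \<bullet> x = r - H" and r: "r > 0"
    and H: "H > 2 * r" and z: "norm (x + s1 *\<^sub>R e) \<le> r" "norm (x + s2 *\<^sub>R f) \<le> r"
  shows "(norm (f - e))\<^sup>2 * (H * (H - 2 * r)) \<le> 2 * r\<^sup>2 * (norm e * norm f + e \<bullet> f)"
    and "\<bar>cross2 e f\<bar> = H * norm (f - e)"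
proof -
  define t where "t = norm (f - e)"
  have uf: "u \<bullet> (f - e) = 0" using ue by (simp add: inner_diff)
  have "cross2 e f = cross2 e (f - e)" by (simp add: cross2_def algebra_simps)
  also have "\<bar>\<dots>\<bar> = H * t"
    using abs_cross2_orthogonal[OF u uf, of e] ue H r by (simp add: t_def)
  finally show *: "\<bar>cross2 e f\<bar> = H * norm (f - e)" by (simp add: t_def)
  \<comment> \<open>The signed area is split into the three triangles over the sides with apex at
    the origin; sliding a point along a side line leaves its term unchanged.\<close>
  have "cross2 e f = cross2 (x + s1 *\<^sub>R e) e + cross2 (x + e) (f - e) - cross2 (x + s2 *\<^sub>R f) f"
    by (simp add: cross2_def algebra_simps)
  moreover have "\<bar>cross2 (x + s1 *\<^sub>R e) e\<bar> \<le> r * norm e"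
    by (rule order_trans[OF abs_cross2_le]) (simp add: z mult_right_mono)
  moreover have "\<bar>cross2 (x + s2 *\<^sub>R f) f\<bar> \<le> r * norm f"
    by (rule order_trans[OF abs_cross2_le]) (simp add: z mult_right_mono)
  moreover have "\<bar>cross2 (x + e) (f - e)\<bar> = r * t"
    using abs_cross2_orthogonal[OF u uf, of "x + e"] ue ux r by (simp add: t_def inner_add)
  ultimately have "H * t \<le> r * norm e + r * t + r * norm f"
    using * unfolding t_def by linarith
  then have "t * (H - r) \<le> r * (norm e + norm f)" by (simp add: algebra_simps)
  \<comment> \<open>After squaring, \<open>(H - r)\<^sup>2 = H * (H - 2 * r) + r\<^sup>2\<close> and
    the law of cosines for \<open>t\<close> combine to the claim.\<close>
  then have "(t * (H - r))\<^sup>2 \<le> (r * (norm e + norm f))\<^sup>2"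
    using H r by (intro power_mono) (auto simp: t_def)
  moreover have "t\<^sup>2 = (norm e)\<^sup>2 + (norm f)\<^sup>2 - 2 * (e \<bullet> f)"
    unfolding t_def power2_norm_eq_inner by (simp add: inner_diff inner_commute)
  moreover have "(r * (norm e + norm f))\<^sup>2 = r\<^sup>2 * ((norm e)\<^sup>2 + (norm f)\<^sup>2 + 2 * (norm e * norm f))"
    by (simp add: power2_eq_square algebra_simps)
  moreover have "(t * (H - r))\<^sup>2 = t\<^sup>2 * (H * (H - 2 * r)) + r\<^sup>2 * t\<^sup>2"
    by (simp add: power2_eq_square algebra_simps)
  ultimately have le: "t\<^sup>2 * (H * (H - 2 * r)) + r\<^sup>2 * t\<^sup>2 \<le> r\<^sup>2 * ((norm e)\<^sup>2 + (norm f)\<^sup>2 + 2 * (norm e * norm f))"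
    and t2: "t\<^sup>2 = (norm e)\<^sup>2 + (norm f)\<^sup>2 - 2 * (e \<bullet> f)" by simp_all
  have "r\<^sup>2 * ((norm e)\<^sup>2 + (norm f)\<^sup>2 + 2 * (norm e * norm f)) - r\<^sup>2 * t\<^sup>2 = 2 * r\<^sup>2 * (norm e * norm f + e \<bullet> f)"
    unfolding t2 by (simp add: right_diff_distrib distrib_left)
  then show "(norm (f - e))\<^sup>2 * (H * (H - 2 * r)) \<le> 2 * r\<^sup>2 * (norm e * norm f + e \<bullet> f)"
    using le unfolding t_def[symmetric] by linarith
qed

text \<open>The prolonged base is \<open>s *\<^sub>R (q - p) + (s' - s) *\<^sub>R (x - p)\<close>,
  and the two summands form no obtuse angle.\<close>

lemma extended_base_ge:
  fixes x p q :: "'a::real_inner"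
  assumes "(x - p) \<bullet> (q - p) \<ge> 0" "0 \<le> s" "s \<le> s'" "1 \<le> s"
  shows "norm (q - p) \<le> norm (s *\<^sub>R (q - x) - s' *\<^sub>R (p - x))"
proof (rule power2_le_imp_le)
  define a where "a = q - p"
  define b where "b = x - p"
  have eq: "s *\<^sub>R (q - x) - s' *\<^sub>R (p - x) = s *\<^sub>R a + (s' - s) *\<^sub>R b"
    by (simp add: a_def b_def algebra_simps)
  have "(norm (s *\<^sub>R (q - x) - s' *\<^sub>R (p - x)))\<^sup>2
     = s\<^sup>2 * (norm a)\<^sup>2 + 2 * s * (s' - s) * (b \<bullet> a) + (s' - s)\<^sup>2 * (norm b)\<^sup>2"
    unfolding power2_norm_eq_inner eq
    by (simp add: inner_add inner_commute[of a b] power2_eq_square algebra_simps)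
  also have "\<dots> = s\<^sup>2 * (norm (q - p))\<^sup>2 + 2 * s * (s' - s) * ((x - p) \<bullet> (q - p)) + (s' - s)\<^sup>2 * (norm (x - p))\<^sup>2"
    by (simp add: a_def b_def)
  also have "\<dots> \<ge> s\<^sup>2 * (norm (q - p))\<^sup>2" using assms by simp
  also have "s\<^sup>2 * (norm (q - p))\<^sup>2 \<ge> 1 * (norm (q - p))\<^sup>2"
    using assms(4) by (intro mult_right_mono) auto
  finally show "(norm (q - p))\<^sup>2 \<le> (norm (s *\<^sub>R (q - x) - s' *\<^sub>R (p - x)))\<^sup>2" by simp
qed simp

text \<open>The main configuration, with \<open>p\<close>, \<open>q\<close>, \<open>x\<close> in
  three different cones. The tangent triangle bounds \<open>cot (A/2)\<close> at \<open>x\<close>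
  from below, the enclosing disc from above.\<close>

lemma three_contact_bound:
  fixes u v t p q x c :: "real^2"
  assumes n: "norm u = 1" "norm v = 1" "norm t = 1"
    and l: "l1 > 0" "l2 > 0" "l3 > 0" "l1 *\<^sub>R u + l2 *\<^sub>R v + l3 *\<^sub>R t = 0"
    and r: "r > 0" and w: "w > 2 * r"
    and x: "x = a2 *\<^sub>R v + a3 *\<^sub>R t" "a2 \<ge> 0" "a3 \<ge> 0" "x \<bullet> u \<le> r - w" "x \<bullet> v \<le> r" "x \<bullet> t \<le> r"
    and p: "p = b1 *\<^sub>R u + b2 *\<^sub>R v" "b1 \<ge> 0" "b2 \<ge> 0" "p \<bullet> u \<le> r" "p \<bullet> v \<le> r"
    and q: "q = c1 *\<^sub>R u + c3 *\<^sub>R t" "c1 \<ge> 0" "c3 \<ge> 0" "q \<bullet> u \<le> r" "q \<bullet> t \<le> r"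
    and acute: "(x - p) \<bullet> (q - p) \<ge> 0" "(x - q) \<bullet> (p - q) \<ge> 0"
    and D: "norm (q - p) = D" "D > 0"
    and R: "norm (x - c) \<le> R" "norm (p - c) \<le> R" "norm (q - c) \<le> R"
  shows "D\<^sup>2 * (w - 2 * r) \<le> 4 * r\<^sup>2 * (R + sqrt (R\<^sup>2 - D\<^sup>2/4))"
proof -
  define H where "H = r - u \<bullet> x"
  have Hw: "H \<ge> w" using x(4) by (simp add: H_def inner_commute)
  have H2: "H > 2 * r" using Hw w by simp
  have sw: "t *\<^sub>R v + s *\<^sub>R u = s *\<^sub>R u + t *\<^sub>R v" for s t :: real and u v :: "real^2" by (rule add.commute)
  have pv: "p \<bullet> v \<ge> - r" and pu: "p \<bullet> u \<ge> - r"
    using cone_inner_lower_bound[OF n(1,2) p(1,2,3,4)]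
      cone_inner_lower_bound[OF n(2,1) _ p(3,2,5)] p(1) sw by auto
  have qt: "q \<bullet> t \<ge> - r" and qu: "q \<bullet> u \<ge> - r"
    using cone_inner_lower_bound[OF n(1,3) q(1,2,3,4)]
      cone_inner_lower_bound[OF n(3,1) _ q(3,2,5)] q(1) sw by auto
  have xt: "x \<bullet> t \<ge> - r" and xv: "x \<bullet> v \<ge> - r"
    using cone_inner_lower_bound[OF n(2,3) x(1,2,3,5)]
      cone_inner_lower_bound[OF n(3,2) _ x(3,2,6)] x(1) sw by auto
  have "\<exists>s. norm (x + s *\<^sub>R (p - x)) \<le> r"
    by (rule cone_segment_meets_ball[OF n l x(1-3) p(1-3)]) (use xv x(5) pv p(5) in auto)
  then obtain s1 where s1: "norm (x + s1 *\<^sub>R (p - x)) \<le> r" by blast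
  have "l1 *\<^sub>R u + l3 *\<^sub>R t + l2 *\<^sub>R v = 0" "x = a3 *\<^sub>R t + a2 *\<^sub>R v"
    using l(4) x(1) by (simp_all add: algebra_simps)
  then have "\<exists>s. norm (x + s *\<^sub>R (q - x)) \<le> r"
    by (rule cone_segment_meets_ball[OF n(1,3,2) l(1,3,2) _ _ x(3,2) q(1-3)]) (use xt x(6) qt q(5) in auto)
  then obtain s2 where s2: "norm (x + s2 *\<^sub>R (q - x)) \<le> r" by blast
  \<comment> \<open>These factors prolong \<open>xp\<close> and \<open>xq\<close> until they reach
    the tangent line on which \<open>u\<close> has inner product \<open>r\<close>.\<close>
  define sp where "sp = H / (u \<bullet> (p - x))"
  define sq where "sq = H / (u \<bullet> (q - x))"
  have up: "0 < u \<bullet> (p - x)" "u \<bullet> (p - x) \<le> H" using pu p(4) H2 r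
    by (simp_all add: H_def inner_diff inner_commute)
  have uq: "0 < u \<bullet> (q - x)" "u \<bullet> (q - x) \<le> H" using qu q(4) H2 r
    by (simp_all add: H_def inner_diff inner_commute)
  have sp: "sp \<ge> 1" and sq: "sq \<ge> 1" using up uq by (simp_all add: sp_def sq_def)
  define e where "e = sp *\<^sub>R (p - x)"
  define f where "f = sq *\<^sub>R (q - x)"
  define N where "N = \<bar>cross2 (p - x) (q - x)\<bar>"
  define T where "T = norm (f - e)"
  define M where "M = norm (p - x) * norm (q - x) + (p - x) \<bullet> (q - x)"
  have ue: "u \<bullet> e = H" "u \<bullet> f = H" using up uq by (simp_all add: e_def f_def sp_def sq_def)
  have ux: "u \<bullet> x = r - H" by (simp add: H_def)
  have z: "norm (x + (s1 / sp) *\<^sub>R e) \<le> r" "norm (x + (s2 / sq) *\<^sub>R f) \<le> r"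
    using s1 s2 sp sq by (simp_all add: e_def f_def)
  have DT: "D \<le> T"
  proof (cases "sq \<le> sp")
    case True
    then show ?thesis using extended_base_ge[OF acute(1), of sq sp] sq D(1) by (simp add: T_def e_def f_def)
  next
    case False
    then show ?thesis using extended_base_ge[OF acute(2), of sp sq] sp D(1)
      by (simp add: T_def e_def f_def norm_minus_commute)
  qed
  have tri: "T\<^sup>2 * (H * (H - 2 * r)) \<le> 2 * r\<^sup>2 * (norm e * norm f + e \<bullet> f)"
    and cr: "\<bar>cross2 e f\<bar> = H * T"
    using base_triangle_bound[OF n(1) ue ux r H2 z] by (simp_all add: T_def)
  have eM: "norm e * norm f + e \<bullet> f = sp * sq * M"
    using sp sq by (simp add: e_def f_def M_def distrib_left)
  \<comment> \<open>Prolonging the sides keeps the angle at \<open>x\<close>: area and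
    \<open>M\<close> both scale by \<open>sp * sq\<close>, which cancels below. The ratio
    \<open>M / N\<close> is \<open>cot (A/2)\<close>.\<close>
  have HT: "H * T = sp * sq * N"
  proof -
    have "cross2 e f = sp * sq * cross2 (p - x) (q - x)" by (simp add: e_def f_def cross2_def algebra_simps)
    then show ?thesis using cr sp sq by (simp add: N_def abs_mult)
  qed
  have "(sp * sq) * (T * (H - 2 * r) * N) = T * (H - 2 * r) * (H * T)" by (simp add: HT)
  also have "\<dots> = T\<^sup>2 * (H * (H - 2 * r))" by (simp add: power2_eq_square)
  also have "\<dots> \<le> (sp * sq) * (2 * r\<^sup>2 * M)" using tri by (simp add: eM mult_ac)
  finally have "(sp * sq) * (T * (H - 2 * r) * N) \<le> (sp * sq) * (2 * r\<^sup>2 * M)" .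
  then have 1: "T * (H - 2 * r) * N \<le> 2 * r\<^sup>2 * M" using sp sq by simp
  have "H * T > 0" using DT D(2) H2 r by simp
  then have N0: "N > 0" using HT sp sq by (simp add: N_def zero_less_mult_iff)
  have "D * (w - 2 * r) \<le> T * (H - 2 * r)"
    using DT Hw w D(2) by (intro mult_mono) auto
  then have "D * (w - 2 * r) * N \<le> T * (H - 2 * r) * N" using N0 by simp
  then have "D * (w - 2 * r) * N \<le> 2 * r\<^sup>2 * M" using 1 by simp
  then have "D * (D * (w - 2 * r) * N) \<le> D * (2 * r\<^sup>2 * M)" using D(2) by (intro mult_left_mono) auto
  also have "\<dots> = 2 * r\<^sup>2 * (D * M)" by simp
  also have "D * M \<le> 2 * N * (R + sqrt (R\<^sup>2 - D\<^sup>2/4))"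
    unfolding M_def using R acute D N0 cross2_inner_sq[of "p - x" "q - x"]
    by (intro circumball_cot_bound) (auto simp: N_def)
  finally have "N * (D\<^sup>2 * (w - 2 * r)) \<le> N * (4 * r\<^sup>2 * (R + sqrt (R\<^sup>2 - D\<^sup>2/4)))"
    using r by (simp add: power2_eq_square algebra_simps)
  then show ?thesis using N0 by simp
qed

section \<open>Inball and contact points\<close>

text \<open>A segment from \<open>c\<close> to a point outside \<open>K\<close> meets the frontier
  strictly before its end.\<close>

lemma cball_subset_if_frontier_far:
  fixes K :: "'a::euclidean_space set"
  assumes "closed K" "c \<in> K" "\<And>z. z \<in> frontier K \<Longrightarrow> s \<le> dist c z"
  shows "cball c s \<subseteq> K"
proof (rule ccontr)
  assume "\<not> cball c s \<subseteq> K"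
  then obtain y where y: "dist c y \<le> s" "y \<notin> K" by (auto simp: subset_iff)
  then have "closed_segment c y \<inter> frontier K \<noteq> {}"
    using assms(2) by (intro connected_Int_frontier) (auto simp: connected_segment)
  then obtain z where z: "z \<in> closed_segment c y" "z \<in> frontier K" by blast
  have "z \<in> K" using z(2) frontier_subset_closed[OF assms(1)] by blast
  then have "dist z y > 0" using y(2) by auto
  moreover have "dist c y = dist c z + dist z y"
    using z(1) by (simp add: between_mem_segment[symmetric] between)
  ultimately show False using assms(3)[OF z(2)] y(1) by linarith
qed

lemma cball_subset_frontier_far:
  fixes K :: "'a::real_normed_vector set"
  assumes "cball c s \<subseteq> K" "z \<in> frontier K"
  shows "s \<le> dist c z"
proof (rule ccontr)
  assume "\<not> s \<le> dist c z"
  then have "z \<in> ball c s" by simp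
  moreover have "ball c s \<subseteq> interior K"
    using assms(1) ball_subset_cball by (intro interior_maximal) (auto simp: subset_iff)
  ultimately show False using assms(2) by (auto simp: frontier_def)
qed

text \<open>An incenter is a maximum point of the distance to the frontier, a continuous function on
  a compact set.\<close>

lemma convex_body_inball:
  fixes K :: "'a::euclidean_space set"
  assumes "convex_body K"
  obtains c r where "r > 0" "cball c r \<subseteq> K" "inradius K = r" "\<And>c' s. cball c' s \<subseteq> K \<Longrightarrow> s \<le> r"
proof -
  have K: "compact K" "interior K \<noteq> {}" using assms by (auto simp: convex_body_def)
  have ne: "K \<noteq> {}" using K(2) by auto
  have F: "frontier K \<noteq> {}" using ne K(1) by (metis compact_imp_bounded frontier_not_empty not_bounded_UNIV)
  have "continuous_on K (\<lambda>y. infdist y (frontier K))" by (intro continuous_intros)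
  then obtain c where c: "c \<in> K" "\<And>y. y \<in> K \<Longrightarrow> infdist y (frontier K) \<le> infdist c (frontier K)"
    using continuous_attains_sup[OF K(1) ne, of "\<lambda>y. infdist y (frontier K)"] by blast
  define r where "r = infdist c (frontier K)"
  have 1: "cball c r \<subseteq> K"
    using c(1) compact_imp_closed[OF K(1)]
    by (intro cball_subset_if_frontier_far) (auto simp: r_def infdist_le)
  \<comment> \<open>For negative \<open>s\<close> the ball is empty and the inclusion says nothing
    about \<open>c'\<close>.\<close>
  have 2: "s \<le> r" if "cball c' s \<subseteq> K" for c' s
  proof (cases "s < 0")
    case True
    then show ?thesis using infdist_nonneg[of c "frontier K"] by (simp add: r_def)
  next
    case False
    then have "c' \<in> K" using that by (auto simp: subset_iff)
    moreover have "s \<le> infdist c' (frontier K)"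
      using F cball_subset_frontier_far[OF that] by (auto simp: infdist_def intro!: cINF_greatest)
    ultimately show ?thesis using c(2) unfolding r_def by fastforce
  qed
  obtain c' e where "e > 0" "cball c' e \<subseteq> K"
    using K(2) by (metis ex_in_conv mem_interior_cball)
  then have 3: "r > 0" using 2 by fastforce
  have "inradius K = r"
    unfolding inradius_def by (rule cSup_eq_maximum) (use 1 2 in auto)
  then show ?thesis using that 1 2 3 by blast
qed

text \<open>Otherwise a hyperplane separates the center from all contact points, and shifting the ball
  away from them leaves room to enlarge it.\<close>

lemma center_in_contact_hull:
  fixes K :: "'a::euclidean_space set"
  assumes K: "compact K" and r: "r > 0" "cball c r \<subseteq> K" and max: "\<And>c' s. cball c' s \<subseteq> K \<Longrightarrow> s \<le> r"
  shows "c \<in> convex hull (frontier K \<inter> sphere c r)"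
proof (rule ccontr)
  define C where "C = frontier K \<inter> sphere c r"
  assume "c \<notin> convex hull (frontier K \<inter> sphere c r)"
  moreover have "compact C" using K by (simp add: C_def compact_Int compact_frontier)
  ultimately obtain a b where ab: "a \<bullet> c < b" "\<And>z. z \<in> C \<Longrightarrow> b < a \<bullet> z"
    using separating_hyperplane_closed_point[of "convex hull C" c]
    by (metis C_def compact_convex_hull compact_imp_closed convex_convex_hull hull_inc)
  have ne: "K \<noteq> {}" using r by auto
  have F: "frontier K \<noteq> {}" using ne K by (metis compact_imp_bounded frontier_not_empty not_bounded_UNIV)
  have rF: "r \<le> dist c z" if "z \<in> frontier K" for z using cball_subset_frontier_far[OF r(2) that] .
  \<comment> \<open>The frontier on the side of \<open>c\<close> turned away from the contact
    points. It is compact without contact points, hence at distance at least some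
    \<open>m > r\<close>.\<close>
  define F1 where "F1 = frontier K \<inter> {z. a \<bullet> (z - c) \<le> 0}"
  have "compact F1" unfolding F1_def
    using K by (intro compact_Int_closed compact_frontier closed_Collect_le continuous_intros)
  have F1r: "r < dist c z" if "z \<in> F1" for z
  proof -
    have "z \<notin> C" using ab(1) ab(2)[of z] that by (auto simp: F1_def inner_diff)
    then show ?thesis using rF[of z] that by (auto simp: F1_def C_def)
  qed
  obtain m where m: "r < m" "\<And>z. z \<in> F1 \<Longrightarrow> m \<le> dist c z"
  proof (cases "F1 = {}")
    case True
    then show ?thesis using that[of "r + 1"] by auto
  next
    case False
    have "continuous_on F1 (dist c)" by (intro continuous_intros)
    then obtain z where "z \<in> F1" "\<forall>y\<in>F1. dist c z \<le> dist c y"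
      using continuous_attains_inf[OF \<open>compact F1\<close> False] by blast
    then show ?thesis using that[of "dist c z"] F1r by blast
  qed
  \<comment> \<open>A zero normal could only come from an empty contact set; then the ball could
    grow around \<open>c\<close> itself.\<close>
  have "a \<noteq> 0"
  proof
    assume "a = 0"
    then have "F1 = frontier K" by (auto simp: F1_def)
    then have "m \<le> r"
      using max[of c m] cball_subset_if_frontier_far[of K c m] m(2) K r compact_imp_closed
      by (auto simp: subset_iff)
    then show False using m(1) by simp
  qed
  \<comment> \<open>The shift is shorter than \<open>r\<close>, so the new center stays in
    \<open>K\<close>, and shorter than \<open>m - r\<close>, so \<open>F1\<close> stays farther than
    \<open>r\<close>. From the rest of the frontier it moves away.\<close>
  define t where "t = min r (m - r) / (2 * norm a)"
  have t: "t > 0" "norm (t *\<^sub>R a) < r" "norm (t *\<^sub>R a) < m - r"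
    using \<open>a \<noteq> 0\<close> r m(1) by (auto simp: t_def min_def)
  define c' where "c' = c - t *\<^sub>R a"
  have c'K: "c' \<in> K" using t(2) r(2) by (auto simp: c'_def dist_norm subset_iff)
  have far: "r < dist c' z" if z: "z \<in> frontier K" for z
  proof (cases "z \<in> F1")
    case True
    have "dist c z \<le> dist c c' + dist c' z" by (rule dist_triangle)
    moreover have "dist c c' < m - r" using t(3) by (simp add: c'_def dist_norm)
    ultimately show ?thesis using m(2)[OF True] by linarith
  next
    case False
    then have pos: "a \<bullet> (z - c) > 0" using z by (auto simp: F1_def)
    have "(dist c' z)\<^sup>2 = (dist c z)\<^sup>2 + 2 * t * (a \<bullet> (z - c)) + t\<^sup>2 * (a \<bullet> a)"
      unfolding dist_norm power2_norm_eq_inner c'_def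
      by (simp add: inner_diff inner_commute power2_eq_square algebra_simps)
    moreover have "2 * t * (a \<bullet> (z - c)) > 0" using t(1) pos by simp
    moreover have "t\<^sup>2 * (a \<bullet> a) \<ge> 0" by simp
    moreover have "r\<^sup>2 \<le> (dist c z)\<^sup>2" using rF[OF z] r by (intro power_mono) auto
    ultimately have "r\<^sup>2 < (dist c' z)\<^sup>2" by linarith
    then show ?thesis by (rule power2_less_imp_less) simp
  qed
  have "continuous_on (frontier K) (dist c')" by (intro continuous_intros)
  then obtain z0 where z0: "z0 \<in> frontier K" "\<forall>y\<in>frontier K. dist c' z0 \<le> dist c' y"
    using continuous_attains_inf[OF compact_frontier[OF K] F] by blast
  have "cball c' (dist c' z0) \<subseteq> K"
    using c'K z0 compact_imp_closed[OF K] by (intro cball_subset_if_frontier_far) auto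
  then show False using max far[OF z0(1)] by fastforce
qed

text \<open>A supporting hyperplane at \<open>z\<close> also supports the ball, so equality in
  Cauchy-Schwarz makes its normal parallel to \<open>z - c\<close>.\<close>

lemma contact_halfspace:
  fixes K :: "'a::euclidean_space set"
  assumes "convex K" "interior K \<noteq> {}" and r: "r > 0" "cball c r \<subseteq> K"
    and z: "z \<in> frontier K" "dist c z = r" and y: "y \<in> K"
  shows "(y - c) \<bullet> (z - c) \<le> r\<^sup>2"
proof -
  have "z \<in> closure K" "z \<notin> rel_interior K"
    using z(1) assms(2) by (auto simp: frontier_def rel_interior_nonempty_interior)
  then obtain a where a: "a \<noteq> 0" "\<And>y. y \<in> closure K \<Longrightarrow> a \<bullet> z \<le> a \<bullet> y"
    using supporting_hyperplane_relative_frontier[OF assms(1)] by metis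
  have cl: "K \<subseteq> closure K" by (rule closure_subset)
  define d where "d = c - z"
  have d: "norm d = r" using z(2) by (simp add: d_def dist_norm)
  \<comment> \<open>The point of the ball lying deepest in direction \<open>- a\<close>.\<close>
  have "c - (r / norm a) *\<^sub>R a \<in> K" using r a(1) by (auto simp: dist_norm subset_iff)
  then have "a \<bullet> z \<le> a \<bullet> (c - (r / norm a) *\<^sub>R a)" using a(2) cl by blast
  also have "\<dots> = a \<bullet> c - r * norm a"
    using a(1) by (simp add: inner_diff_right dot_square_norm power2_eq_square)
  finally have "norm a * norm d \<le> a \<bullet> d"
    unfolding d by (simp add: d_def inner_diff_right mult.commute)
  then have "a \<bullet> d = norm a * norm d" using norm_cauchy_schwarz[of a d] by simp
  then have "norm a *\<^sub>R d = norm d *\<^sub>R a" by (simp add: norm_cauchy_schwarz_eq)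
  then have "inverse (norm a) *\<^sub>R norm a *\<^sub>R d = inverse (norm a) *\<^sub>R r *\<^sub>R a" by (simp only: d)
  then have "d = (r / norm a) *\<^sub>R a" using a(1) by (simp add: divide_inverse_commute)
  moreover have "0 \<le> a \<bullet> (y - z)" using a(2)[of y] y cl by (auto simp: inner_diff)
  ultimately have "0 \<le> d \<bullet> (y - z)" using r by simp
  moreover have "(y - c) \<bullet> (z - c) = d \<bullet> d - d \<bullet> (y - z)"
    by (simp add: d_def inner_diff inner_commute)
  moreover have "d \<bullet> d = r\<^sup>2" using d by (simp flip: power2_norm_eq_inner)
  ultimately show ?thesis by simp
qed

text \<open>Caratheodory in dimension two; the points may coincide, which covers smaller
  sets.\<close>

lemma convex_hull_plane_three_points:
  fixes C :: "(real^2) set"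
  assumes "x \<in> convex hull C"
  obtains a b c where "a \<in> C" "b \<in> C" "c \<in> C" "x \<in> convex hull {a, b, c}"
proof -
  obtain S where S: "finite S" "S \<subseteq> C" "card S \<le> 3" "x \<in> convex hull S"
    using assms caratheodory[of C] by auto
  then have "S \<noteq> {}" by auto
  then have "card S = 1 \<or> card S = 2 \<or> card S = 3" using S card_gt_0_iff[of S] by linarith
  then obtain a b c where "S = {a, b, c}"
    by (metis card_1_singletonE card_2_iff card_3_iff insert_absorb2)
  then show ?thesis using S that by auto
qed

text \<open>The extent of \<open>K\<close> in direction \<open>u\<close> is at least the width, and
  its upper end is at most \<open>B\<close>.\<close>

lemma width_witness:
  fixes K :: "'a::euclidean_space set"
  assumes K: "compact K" "K \<noteq> {}" and u: "norm u = 1" and B: "\<And>y. y \<in> K \<Longrightarrow> u \<bullet> y \<le> B"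
  obtains x where "x \<in> K" "u \<bullet> x \<le> B - width K"
proof -
  have cont: "continuous_on K ((\<bullet>) v)" for v :: 'a by (intro continuous_intros)
  have bdd: "bdd_above ((\<bullet>) v ` K)" "bdd_below ((\<bullet>) v ` K)" for v :: 'a
    by (intro bounded_imp_bdd_above bounded_imp_bdd_below compact_imp_bounded compact_continuous_image cont K(1))+
  obtain x where x: "x \<in> K" "\<And>y. y \<in> K \<Longrightarrow> u \<bullet> x \<le> u \<bullet> y"
    using continuous_attains_inf[OF K cont] by blast
  \<comment> \<open>Supplies the lower bound that makes the infimum in \<open>width\<close>
    meaningful.\<close>
  have nonneg: "0 \<le> (SUP x\<in>K. v \<bullet> x) - (INF x\<in>K. v \<bullet> x)" for v
    using K(2) bdd[of v] by (metis cINF_lower cSUP_upper2 diff_ge_0_iff_ge ex_in_conv)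
  have "width K \<le> (SUP x\<in>K. u \<bullet> x) - (INF x\<in>K. u \<bullet> x)"
    unfolding width_def using u nonneg by (intro cINF_lower) (auto intro!: bdd_belowI[where m=0])
  also have "\<dots> \<le> B - u \<bullet> x"
    using K(2) B x by (intro diff_mono cSUP_least cINF_greatest) auto
  finally show ?thesis using that x(1) by auto
qed
section \<open>The bound for three contact points\<close>

definition in_cone :: "'a::real_vector \<Rightarrow> 'a \<Rightarrow> 'a \<Rightarrow> bool" where
  "in_cone u v y \<longleftrightarrow> (\<exists>a b. 0 \<le> a \<and> 0 \<le> b \<and> y = a *\<^sub>R u + b *\<^sub>R v)"

lemma in_cone_commute: "in_cone u v y \<longleftrightarrow> in_cone v u y"
  unfolding in_cone_def by (metis add.commute)

lemma in_cone_scale_left: "0 \<le> a \<Longrightarrow> in_cone u v (a *\<^sub>R u)"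
  unfolding in_cone_def by (rule exI[of _ a], rule exI[of _ 0]) simp

text \<open>Expand \<open>y\<close> in the basis \<open>u\<close>, \<open>v\<close>. If a
  coefficient is negative, subtract the multiple of the zero relation that annihilates the smaller
  of \<open>a / l1\<close> and \<open>b / l2\<close>; the other two coefficients are then
  nonnegative.\<close>

lemma cones_cover_plane:
  fixes u v t :: "real^2"
  assumes n: "norm u = 1" "norm v = 1" and ne: "u \<noteq> v" "u \<noteq> - v"
    and l: "l1 > 0" "l2 > 0" "l3 > 0" "l1 *\<^sub>R u + l2 *\<^sub>R v + l3 *\<^sub>R t = 0"
  shows "in_cone u v y \<or> in_cone u t y \<or> in_cone v t y"
proof -
  have "cross2 u v \<noteq> 0"
  proof
    assume "cross2 u v = 0"
    then have "(u \<bullet> v)\<^sup>2 = 1" using cross2_inner_sq[of u v] n by simp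
    then have "\<bar>u \<bullet> v\<bar> = norm u * norm v" using n by (simp add: abs_square_eq_1)
    then have "norm u *\<^sub>R v = norm v *\<^sub>R u \<or> norm u *\<^sub>R v = - norm v *\<^sub>R u"
      by (simp only: norm_cauchy_schwarz_abs_eq[symmetric])
    then show False using ne n by auto
  qed
  define a where "a = cross2 y v / cross2 u v"
  define b where "b = cross2 u y / cross2 u v"
  have y: "y = a *\<^sub>R u + b *\<^sub>R v"
  proof -
    have "cross2 u v *\<^sub>R y = cross2 y v *\<^sub>R u + cross2 u y *\<^sub>R v"
      by (simp add: vec_eq_iff forall_2 cross2_def algebra_simps)
    then have "inverse (cross2 u v) *\<^sub>R cross2 u v *\<^sub>R y = inverse (cross2 u v) *\<^sub>R (cross2 y v *\<^sub>R u + cross2 u y *\<^sub>R v)"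
      by simp
    then show ?thesis using \<open>cross2 u v \<noteq> 0\<close> by (simp add: a_def b_def scaleR_add_right divide_inverse_commute)
  qed
  have shift: "y = (a - m * l1) *\<^sub>R u + (b - m * l2) *\<^sub>R v + (- m * l3) *\<^sub>R t" for m
  proof -
    have "(a - m * l1) *\<^sub>R u + (b - m * l2) *\<^sub>R v + (- m * l3) *\<^sub>R t = y - m *\<^sub>R (l1 *\<^sub>R u + l2 *\<^sub>R v + l3 *\<^sub>R t)"
      by (simp add: y algebra_simps)
    then show ?thesis using l(4) by simp
  qed
  consider "0 \<le> a" "0 \<le> b" | "a / l1 \<le> 0" "a / l1 \<le> b / l2" | "b / l2 \<le> 0" "b / l2 \<le> a / l1"
    using l by (smt (verit) divide_nonneg_pos divide_nonpos_pos zero_le_divide_iff)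
  then show ?thesis
  proof cases
    case 1
    then show ?thesis using y by (auto simp: in_cone_def)
  next
    case 2
    have "0 \<le> b - a / l1 * l2" "0 \<le> - (a / l1) * l3"
      using 2 l by (auto simp: field_simps mult_le_0_iff)
    moreover have "y = (b - a / l1 * l2) *\<^sub>R v + (- (a / l1) * l3) *\<^sub>R t"
      using shift[of "a / l1"] l(1) by simp
    ultimately show ?thesis unfolding in_cone_def by blast
  next
    case 3
    have "0 \<le> a - b / l2 * l1" "0 \<le> - (b / l2) * l3"
      using 3 l by (auto simp: field_simps mult_le_0_iff)
    moreover have "y = (a - b / l2 * l1) *\<^sub>R u + (- (b / l2) * l3) *\<^sub>R t"
      using shift[of "b / l2"] l(2) by simp
    ultimately show ?thesis unfolding in_cone_def by blast
  qed
qed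

text \<open>Comparing norms gives \<open>a = b\<close>. It shows that a vanishing weight would leave
  two opposite contact normals.\<close>

lemma antipodal_if_zero_combination:
  fixes u v :: "'a::real_normed_vector"
  assumes "norm u = 1" "norm v = 1" "0 \<le> a" "0 \<le> b" "a + b = 1" "a *\<^sub>R u + b *\<^sub>R v = 0"
  shows "u = - v"
proof -
  have eq: "a *\<^sub>R u = - (b *\<^sub>R v)" using assms(6) by (simp add: eq_neg_iff_add_eq_0)
  then have "norm (a *\<^sub>R u) = norm (b *\<^sub>R v)" by simp
  then have "a = b" using assms by simp
  then show ?thesis using eq assms(5) by (metis add_0 mult_zero_left scaleR_cancel_left scaleR_minus_right zero_neq_one add.right_neutral)
qed

text \<open>Relabelling the normals reduces to \<open>three_contact_bound\<close> once
  \<open>p\<close> and \<open>q\<close> occupy different cones. If they share one, an endpoint is a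
  contact point, lying on a ray common to two cones.\<close>

lemma contact_triangle_bound:
  fixes S :: "(real^2) set"
  assumes n: "norm u = 1" "norm v = 1" "norm t = 1"
    and l: "0 \<le> a" "0 \<le> b" "0 \<le> c" "a + b + c = 1" "a *\<^sub>R u + b *\<^sub>R v + c *\<^sub>R t = 0"
    and le: "\<And>y z. z \<in> {u, v, t} \<Longrightarrow> y \<in> S \<Longrightarrow> y \<bullet> z \<le> r"
    and wide: "\<And>z. z \<in> {u, v, t} \<Longrightarrow> \<exists>x\<in>S. x \<bullet> z \<le> r - w"
    and r: "r > 0" "cball 0 r \<subseteq> S" and w: "w > 2 * r"
    and pq: "p \<in> S" "q \<in> S" "norm (q - p) = D" "D > 0"
    and diam: "\<And>x y. x \<in> S \<Longrightarrow> y \<in> S \<Longrightarrow> norm (x - y) \<le> D"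
    and R: "S \<subseteq> cball o' R"
  shows "D\<^sup>2 * (w - 2 * r) \<le> 4 * r\<^sup>2 * (R + sqrt (R\<^sup>2 - D\<^sup>2/4))"
proof -
  define P where "P = (\<lambda>z::real^2. norm z = 1 \<and> (\<forall>y\<in>S. y \<bullet> z \<le> r) \<and> (\<exists>x\<in>S. x \<bullet> z \<le> r - w))"
  \<comment> \<open>Invariant under permuting the normals, so each case below may be
    relabelled.\<close>
  define G where "G = (\<lambda>u v t::real^2. P u \<and> P v \<and> P t \<and>
    (\<exists>l1 l2 l3. l1 > 0 \<and> l2 > 0 \<and> l3 > 0 \<and> l1 *\<^sub>R u + l2 *\<^sub>R v + l3 *\<^sub>R t = 0))"
  have Puvt: "P u" "P v" "P t" using n le wide by (auto simp: P_def)
  \<comment> \<open>Opposite normals would confine \<open>S\<close> to a strip of width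
    \<open>2 * r < w\<close>.\<close>
  have noanti: "z \<noteq> - z'" if z: "P z" "P z'" for z z'
  proof
    assume zz: "z = - z'"
    obtain x where "x \<in> S" "x \<bullet> z \<le> r - w" using z(1) by (auto simp: P_def)
    moreover have "x \<bullet> z' \<le> r" using z(2) \<open>x \<in> S\<close> by (auto simp: P_def)
    ultimately show False using zz w r by simp
  qed
  have "a \<noteq> 0" using antipodal_if_zero_combination[of v t b c] noanti[OF Puvt(2,3)] n l by auto
  moreover have "b \<noteq> 0" using antipodal_if_zero_combination[of u t a c] noanti[OF Puvt(1,3)] n l by auto
  moreover have "c \<noteq> 0" using antipodal_if_zero_combination[of u v a b] noanti[OF Puvt(1,2)] n l by auto
  ultimately have "a > 0" "b > 0" "c > 0" using l(1-3) by simp_all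
  then have G: "G u v t" unfolding G_def using Puvt l(5) by blast
  have Gswap: "G v u t" "G u t v" if H: "G u v t" for u v t
  proof -
    obtain l1 l2 l3 where l: "P u" "P v" "P t" "l1 > 0" "l2 > 0" "l3 > 0" "l1 *\<^sub>R u + l2 *\<^sub>R v + l3 *\<^sub>R t = 0"
      using H unfolding G_def by blast
    then have "l2 *\<^sub>R v + l1 *\<^sub>R u + l3 *\<^sub>R t = 0" "l1 *\<^sub>R u + l3 *\<^sub>R t + l2 *\<^sub>R v = 0"
      by (simp_all add: ac_simps)
    then show "G v u t" "G u t v" unfolding G_def using l by blast+
  qed
  have ne: "u \<noteq> v" if H: "G u v t" for u v t
  proof
    assume "u = v"
    with H obtain l1 l2 l3 where g: "P u" "P t" "l1 > 0" "l2 > 0" "l3 > 0" "(l1 + l2) *\<^sub>R u + l3 *\<^sub>R t = 0"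
      unfolding G_def by (auto simp: scaleR_left_distrib)
    define k where "k = l1 + l2 + l3"
    have k: "k > 0" using g by (simp add: k_def)
    have "((l1 + l2) / k) *\<^sub>R u + (l3 / k) *\<^sub>R t = inverse k *\<^sub>R ((l1 + l2) *\<^sub>R u + l3 *\<^sub>R t)"
      by (simp add: scaleR_add_right divide_inverse_commute)
    then have "((l1 + l2) / k) *\<^sub>R u + (l3 / k) *\<^sub>R t = 0" using g by simp
    then have "u = - t"
      using g k by (intro antipodal_if_zero_combination[of u t "(l1 + l2) / k" "l3 / k"])
        (auto simp: P_def k_def simp flip: add_divide_distrib)
    then show False using noanti g by blast
  qed
  \<comment> \<open>The law of cosines: next to a longest segment \<open>pq\<close> no angle is
    obtuse.\<close>
  have far: "(x - p) \<bullet> (q - p) \<ge> 0" "(x - q) \<bullet> (p - q) \<ge> 0" if "x \<in> S" for x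
  proof -
    have *: "(x - p) \<bullet> (q - p) \<ge> 0" if "norm (q - p) = D" "norm (x - q) \<le> D" for x p q :: "real^2"
    proof -
      have "(norm (x - q))\<^sup>2 = (norm (x - p))\<^sup>2 - 2 * ((x - p) \<bullet> (q - p)) + (norm (q - p))\<^sup>2"
        unfolding power2_norm_eq_inner by (simp add: inner_diff inner_commute)
      moreover have "(norm (x - q))\<^sup>2 \<le> D\<^sup>2" using that(2) by (intro power_mono) auto
      moreover have "0 \<le> (norm (x - p))\<^sup>2" by simp
      ultimately show ?thesis unfolding that(1) by linarith
    qed
    show "(x - p) \<bullet> (q - p) \<ge> 0" "(x - q) \<bullet> (p - q) \<ge> 0"
      using * pq diam that by (auto simp: norm_minus_commute)
  qed
  have lower: "- r \<le> x \<bullet> z" if zx: "in_cone z z' x" "P z" "P z'" "x \<in> S" for x z z'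
  proof -
    obtain a b where "0 \<le> a" "0 \<le> b" "x = a *\<^sub>R z + b *\<^sub>R z'"
      using zx(1) by (auto simp: in_cone_def)
    then show ?thesis
      using cone_inner_lower_bound[of z' z x b a r] zx by (auto simp: P_def add.commute)
  qed
  have distinct_cones: ?thesis if G: "G u v t" and pc: "in_cone u v p" and qc: "in_cone u t q" for u v t
  proof -
    have Ps: "P u" "P v" "P t" using G by (auto simp: G_def)
    obtain l1 l2 l3 where l: "l1 > 0" "l2 > 0" "l3 > 0" "l1 *\<^sub>R u + l2 *\<^sub>R v + l3 *\<^sub>R t = 0"
      using G by (auto simp: G_def)
    obtain x where x: "x \<in> S" "x \<bullet> u \<le> r - w" using Ps(1) by (auto simp: P_def)
    \<comment> \<open>Here \<open>x \<bullet> u \<le> r - w < - r\<close>, which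
      \<open>lower\<close> forbids in both cones containing \<open>u\<close>.\<close>
    have "\<not> in_cone u v x" "\<not> in_cone u t x" using lower Ps x w by fastforce+
    then have "in_cone v t x"
      using cones_cover_plane[of u v l1 l2 l3 t x] ne[OF G] noanti[OF Ps(1,2)] l Ps by (auto simp: P_def)
    then obtain a2 a3 where xa: "x = a2 *\<^sub>R v + a3 *\<^sub>R t" "a2 \<ge> 0" "a3 \<ge> 0" by (auto simp: in_cone_def)
    obtain b1 b2 where pb: "p = b1 *\<^sub>R u + b2 *\<^sub>R v" "b1 \<ge> 0" "b2 \<ge> 0" using pc by (auto simp: in_cone_def)
    obtain c1 c3 where qc': "q = c1 *\<^sub>R u + c3 *\<^sub>R t" "c1 \<ge> 0" "c3 \<ge> 0" using qc by (auto simp: in_cone_def)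
    have nR: "norm (y - o') \<le> R" if "y \<in> S" for y using R that by (auto simp: dist_norm norm_minus_commute)
    show ?thesis
      by (rule three_contact_bound[OF _ _ _ l r(1) w xa x(2) _ _ pb _ _ qc' _ _ far[OF x(1)] pq(3,4) nR[OF x(1)] nR[OF pq(1)] nR[OF pq(2)]])
        (use Ps pq(1,2) x(1) in \<open>auto simp: P_def\<close>)
  qed
  define d where "d = (1 / D) *\<^sub>R (q - p)"
  have d: "norm d = 1" using pq(3,4) by (simp add: d_def)
  \<comment> \<open>These ends of the disc's diameter parallel to \<open>pq\<close> lie between the
    perpendiculars to \<open>pq\<close> at \<open>p\<close> and \<open>q\<close>, which bounds
    \<open>p \<bullet> d\<close> and \<open>q \<bullet> d\<close>.\<close>
  have rd: "r *\<^sub>R d \<in> S" "- (r *\<^sub>R d) \<in> S" using r d by (auto simp: subset_iff)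
  have pd: "p \<bullet> d \<le> - r"
  proof -
    have "0 \<le> (- (r *\<^sub>R d) - p) \<bullet> d" using far(1)[OF rd(2)] pq(4) by (simp add: d_def)
    then show ?thesis using d by (simp add: inner_diff_left norm_eq_1)
  qed
  have qd: "q \<bullet> (- d) \<le> - r"
  proof -
    have "(r *\<^sub>R d - q) \<bullet> (p - q) = - D * ((r *\<^sub>R d - q) \<bullet> d)"
      using pq(4) by (simp add: d_def inner_diff_right)
    then have "(r *\<^sub>R d - q) \<bullet> d \<le> 0" using far(2)[OF rd(1)] pq(4) by (simp add: mult_le_0_iff zero_le_mult_iff)
    then show ?thesis using d by (simp add: inner_diff_left norm_eq_1)
  qed
  have same_cone: ?thesis if G: "G u v t" and pc: "in_cone u v p" and qc: "in_cone u v q" for u v t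
  proof -
    have Ps: "P u" "P v" "P t" using G by (auto simp: G_def)
    have uv: "u \<bullet> v \<noteq> - 1"
    proof
      assume "u \<bullet> v = - 1"
      then have "(norm (u + v))\<^sup>2 = 0"
        using Ps by (simp add: power2_norm_eq_inner inner_add inner_commute P_def norm_eq_1)
      then show False using noanti[OF Ps(1,2)] by (simp add: eq_neg_iff_add_eq_0)
    qed
    have n: "norm u = 1" "norm v = 1" using Ps by (auto simp: P_def)
    obtain a b where p: "p = a *\<^sub>R u + b *\<^sub>R v" "a \<ge> 0" "b \<ge> 0" using pc by (auto simp: in_cone_def)
    obtain a' b' where q: "q = a' *\<^sub>R u + b' *\<^sub>R v" "a' \<ge> 0" "b' \<ge> 0" using qc by (auto simp: in_cone_def)
    have pS: "p \<bullet> u \<le> r" "p \<bullet> v \<le> r" and qS: "q \<bullet> u \<le> r" "q \<bullet> v \<le> r"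
      using pq Ps by (auto simp: P_def)
    have "p = r *\<^sub>R u \<or> p = r *\<^sub>R v \<or> q = r *\<^sub>R u \<or> q = r *\<^sub>R v"
    \<comment> \<open>The sign decides which endpoint is the contact point: \<open>p\<close> with
      direction \<open>d\<close>, or \<open>q\<close> with \<open>- d\<close>.\<close>
    proof (cases "(u + v) \<bullet> d \<ge> 0")
      case True
      then show ?thesis using same_cone_contact[OF n d uv r(1) p pS pd] by blast
    next
      case False
      then show ?thesis using same_cone_contact[OF n _ uv r(1) q qS qd] d by auto
    qed
    then consider "in_cone u t p" | "in_cone v t p" | "in_cone u t q" | "in_cone v t q"
      using r(1) in_cone_scale_left less_imp_le by metis
    then show ?thesis
    proof cases
      case 1
      then show ?thesis using distinct_cones[OF Gswap(2)[OF G]] qc by blast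
    next
      case 2
      then show ?thesis using distinct_cones[OF Gswap(2)[OF Gswap(1)[OF G]]] qc in_cone_commute by blast
    next
      case 3
      then show ?thesis using distinct_cones[OF G] pc by blast
    next
      case 4
      then show ?thesis using distinct_cones[OF Gswap(1)[OF G]] pc in_cone_commute by blast
    qed
  qed
  have cover: "in_cone u v y \<or> in_cone u t y \<or> in_cone v t y" for y
    using cones_cover_plane[of u v a b c t y] ne[OF G] noanti[OF Puvt(1,2)] l(5) n
      \<open>a > 0\<close> \<open>b > 0\<close> \<open>c > 0\<close> by blast
  have *: ?thesis if "in_cone u v p" "G u v t" "in_cone u v q \<or> in_cone u t q \<or> in_cone v t q" for u v t
    using that distinct_cones same_cone Gswap in_cone_commute by metis
  have G2: "G u t v" and G3: "G v t u" using G Gswap by blast+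
  from cover[of p] show ?thesis
  proof (elim disjE)
    assume "in_cone u v p"
    then show ?thesis using *[OF _ G] cover[of q] by blast
  next
    assume "in_cone u t p"
    then show ?thesis using *[OF _ G2] cover[of q] in_cone_commute by blast
  next
    assume "in_cone v t p"
    then show ?thesis using *[OF _ G3] cover[of q] in_cone_commute by blast
  qed
qed

section \<open>From contact points to the inequality for the circumradius\<close>

text \<open>Treats an arbitrary enclosing disc; the infimum defining the circumradius follows by a
  limit. The incenter is moved to the origin.\<close>

lemma width_bound_circumball:
  fixes K :: "(real^2) set"
  assumes K: "convex_body K" and w: "width K > 2 * inradius K" and R: "K \<subseteq> cball c R"
  shows "(diameter K)\<^sup>2 * (width K - 2 * inradius K)
    \<le> 4 * (inradius K)\<^sup>2 * (R + sqrt (R\<^sup>2 - (diameter K)\<^sup>2 / 4))"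
proof -
  have K': "compact K" "convex K" "interior K \<noteq> {}" "K \<noteq> {}" using K by (auto simp: convex_body_def)
  obtain o' r where r: "r > 0" "cball o' r \<subseteq> K" "inradius K = r"
    and max: "\<forall>c' s. cball c' s \<subseteq> K \<longrightarrow> s \<le> r"
    using convex_body_inball[OF K] by metis
  have "o' \<in> convex hull (frontier K \<inter> sphere o' r)"
    using center_in_contact_hull[OF K'(1) r(1,2)] max by blast
  then obtain x y z where xyz: "x \<in> frontier K \<inter> sphere o' r" "y \<in> frontier K \<inter> sphere o' r"
      "z \<in> frontier K \<inter> sphere o' r" and "o' \<in> convex hull {x, y, z}"
    by (rule convex_hull_plane_three_points)
  then obtain a b c' where abc: "0 \<le> a" "0 \<le> b" "0 \<le> c'" "a + b + c' = 1" and o': "o' = a *\<^sub>R x + b *\<^sub>R y + c' *\<^sub>R z"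
    by (auto simp: convex_hull_3)
  \<comment> \<open>The outer unit normals at contact points; the convex weights representing the
    incenter make their combination vanish.\<close>
  define n where "n = (\<lambda>x::real^2. (1 / r) *\<^sub>R (x - o'))"
  have n1: "norm (n x) = 1" if "x \<in> frontier K \<inter> sphere o' r" for x
    using that r(1) by (simp add: n_def dist_norm norm_minus_commute)
  have n2: "(y - o') \<bullet> n x \<le> r" if "x \<in> frontier K \<inter> sphere o' r" "y \<in> K" for x y
    using contact_halfspace[OF K'(2,3) r(1,2), of x y] that r(1)
    by (simp add: n_def pos_divide_le_eq power2_eq_square)
  have n3: "\<exists>y\<in>K. (y - o') \<bullet> n x \<le> r - width K" if x: "x \<in> frontier K \<inter> sphere o' r" for x
  proof -
    have "n x \<bullet> y \<le> r + n x \<bullet> o'" if "y \<in> K" for y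
      using n2[OF x that] by (simp add: inner_diff_right inner_commute[of _ "n x"])
    then obtain y where "y \<in> K" "n x \<bullet> y \<le> r + n x \<bullet> o' - width K"
      using width_witness[OF K'(1,4) n1[OF x]] by blast
    then show ?thesis by (intro bexI[of _ y]) (auto simp: inner_diff_right inner_commute[of _ "n x"])
  qed
  have zero: "a *\<^sub>R n x + b *\<^sub>R n y + c' *\<^sub>R n z = 0"
  proof -
    have "a *\<^sub>R n x + b *\<^sub>R n y + c' *\<^sub>R n z = (1 / r) *\<^sub>R ((a *\<^sub>R x + b *\<^sub>R y + c' *\<^sub>R z) - (a + b + c') *\<^sub>R o')"
      by (simp add: n_def algebra_simps)
    then show ?thesis using abc(4) o' by simp
  qed
  obtain p q where pq: "p \<in> K" "q \<in> K" "dist p q = diameter K"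
    using diameter_compact_attained[OF K'(1,4)] by blast
  have diam: "norm (x - y) \<le> diameter K" if "x \<in> K" "y \<in> K" for x y
    using diameter_bounded_bound[OF compact_imp_bounded[OF K'(1)] that] by (simp add: dist_norm)
  have D: "diameter K > 0"
  proof -
    have "o' \<in> K" "x \<in> K" "x \<noteq> o'"
      using r(1,2) xyz(1) frontier_subset_closed[OF compact_imp_closed[OF K'(1)]] by auto
    then show ?thesis using diam[of x o'] by (smt (verit) right_minus_eq zero_less_norm_iff)
  qed
  define S where "S = (\<lambda>y. y - o') ` K"
  have "(diameter K)\<^sup>2 * (width K - 2 * r) \<le> 4 * r\<^sup>2 * (R + sqrt (R\<^sup>2 - (diameter K)\<^sup>2 / 4))"
  proof (rule contact_triangle_bound[OF n1[OF xyz(1)] n1[OF xyz(2)] n1[OF xyz(3)] abc zero])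
    show "y' \<bullet> u \<le> r" if "u \<in> {n x, n y, n z}" "y' \<in> S" for u y'
      using that n2 xyz by (auto simp: S_def)
    show "\<exists>y\<in>S. y \<bullet> u \<le> r - width K" if "u \<in> {n x, n y, n z}" for u
      using that n3 xyz by (auto simp: S_def)
    show "r > 0" by fact
    show "cball 0 r \<subseteq> S"
    proof
      fix y :: "real^2" assume "y \<in> cball 0 r"
      then have "y + o' \<in> K" using r(2) by (auto simp: subset_iff dist_norm)
      then show "y \<in> S" unfolding S_def by (intro image_eqI[of _ _ "y + o'"]) auto
    qed
    show "width K > 2 * r" using w r(3) by simp
    show "p - o' \<in> S" "q - o' \<in> S" using pq by (auto simp: S_def)
    show "norm ((q - o') - (p - o')) = diameter K" using pq(3) by (simp add: dist_norm norm_minus_commute)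
    show "diameter K > 0" by fact
    show "norm (u - v) \<le> diameter K" if "u \<in> S" "v \<in> S" for u v
      using that diam by (auto simp: S_def)
    show "S \<subseteq> cball (c - o') R" using R by (auto simp: S_def dist_norm)
  qed
  then show ?thesis using r(3) by simp
qed

theorem theorem3p6:
  fixes K :: "(real^2) set"
  assumes "convex_body K"
  shows "width K \<le> 2 * inradius K * (1 + (2 * inradius K * circumradius K / (diameter K)^2)
           * (1 + sqrt (1 - (diameter K / (2 * circumradius K))^2)))"
proof -
  define r where "r = inradius K"
  define w where "w = width K"
  define D where "D = diameter K"
  define R where "R = circumradius K"
  define B where "B = {s. \<exists>c. K \<subseteq> cball c s}"
  have RB: "R = Inf B" by (simp add: R_def circumradius_def B_def)
  have K: "compact K" "K \<noteq> {}" using assms by (auto simp: convex_body_def)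
  obtain o' where r: "r > 0" "cball o' r \<subseteq> K" using convex_body_inball[OF assms] r_def by metis
  have bK: "bounded K" by (rule compact_imp_bounded[OF K(1)])
  have "diameter (cball o' r) \<le> D" unfolding D_def by (rule diameter_subset[OF r(2) bK])
  then have D: "D > 0" using r(1) by simp
  have BD: "D / 2 \<le> s" if s: "s \<in> B" for s
  proof -
    obtain c where c: "K \<subseteq> cball c s" using s by (auto simp: B_def)
    then have "s \<ge> 0" using K(2) by force
    moreover have "D \<le> diameter (cball c s)" unfolding D_def by (rule diameter_subset[OF c]) simp
    ultimately show ?thesis by simp
  qed
  have B: "B \<noteq> {}" using bK by (auto simp: B_def bounded_subset_cball)
  have DR: "D / 2 \<le> R" unfolding RB using B BD by (rule cInf_greatest)
  then have R: "R > 0" using D by simp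
  have "(D / (2 * R))\<^sup>2 \<le> 1" using DR R D by (simp add: power_le_one)
  then have sq: "0 \<le> sqrt (1 - (D / (2 * R))\<^sup>2)" by simp
  have "w \<le> 2 * r * (1 + (2 * r * R / D\<^sup>2) * (1 + sqrt (1 - (D / (2 * R))\<^sup>2)))"
  proof (cases "w \<le> 2 * r")
    case True
    also have "2 * r \<le> 2 * r * (1 + (2 * r * R / D\<^sup>2) * (1 + sqrt (1 - (D / (2 * R))\<^sup>2)))"
      using r R D sq by simp
    finally show ?thesis .
  next
    case False
    \<comment> \<open>Every \<open>s > R\<close> is the radius of an enclosing disc, and
      \<open>g\<close> is continuous, so the bound passes to \<open>R\<close> from the
      right.\<close>
    define g where "g = (\<lambda>s. 4 * r\<^sup>2 * (s + sqrt (s\<^sup>2 - D\<^sup>2 / 4)))"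
    have "D\<^sup>2 * (w - 2 * r) \<le> g s" if s: "R < s" for s
    proof -
      obtain s' where "s' \<in> B" "s' < s" using cInf_lessD[OF B, of s] s RB by blast
      then obtain c where "K \<subseteq> cball c s'" by (auto simp: B_def)
      then have "K \<subseteq> cball c s" using \<open>s' < s\<close> subset_cball[of s' s c] by simp
      then show ?thesis
        using width_bound_circumball[OF assms] False by (auto simp: g_def w_def r_def D_def)
    qed
    then have "eventually (\<lambda>s. D\<^sup>2 * (w - 2 * r) \<le> g s) (at_right R)"
      by (auto simp: eventually_at_filter)
    moreover have "(g \<longlongrightarrow> g R) (at_right R)"
      unfolding g_def by (intro tendsto_intros)
    ultimately have "D\<^sup>2 * (w - 2 * r) \<le> g R"
      by (intro tendsto_lowerbound) auto
    moreover have "sqrt (R\<^sup>2 - D\<^sup>2 / 4) = R * sqrt (1 - (D / (2 * R))\<^sup>2)"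
    proof -
      have "R\<^sup>2 - D\<^sup>2 / 4 = R\<^sup>2 * (1 - (D / (2 * R))\<^sup>2)"
        using R by (simp add: field_simps power2_eq_square)
      then show ?thesis using R by (simp add: real_sqrt_mult)
    qed
    ultimately have "D\<^sup>2 * (w - 2 * r) \<le> 4 * r\<^sup>2 * R * (1 + sqrt (1 - (D / (2 * R))\<^sup>2))"
      by (simp add: g_def algebra_simps)
    then have "w - 2 * r \<le> 4 * r\<^sup>2 * R * (1 + sqrt (1 - (D / (2 * R))\<^sup>2)) / D\<^sup>2"
      using D by (simp add: pos_le_divide_eq mult.commute)
    also have "\<dots> = 2 * r * ((2 * r * R / D\<^sup>2) * (1 + sqrt (1 - (D / (2 * R))\<^sup>2)))"
      by (simp add: power2_eq_square)
    finally show ?thesis by (simp add: distrib_left)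
  qed
  then show ?thesis by (simp only: r_def w_def D_def R_def)
qed

end
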